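(* Let $(X_1,d_1)$ and $(X_2,d_2)$ be (nonempty) metric spaces and let $(X_1\times X_2,d)$ be their metric product, i.e. $d\big((x_1,x_2),(x_1',x_2')\big) = \big(d_1^2(x_1,x_1')+d_2^2(x_2,x_2')\big)^{1/2}$. Then $$\mathrm{rank}_M(X_1,d_1)+\mathrm{rank}_M(X_2,d_2) = \mathrm{rank}_M(X_1\times X_2,d).$$
   Context: A map between metric spaces is called isometric if it preserves distances (it need not be surjective). A real normed vector space $(V,\|\cdot\|)$ is regarded as a metric space with distance $\|v-w\|$. For a metric space $(X,d)$ the Minkowski rank is $\mathrm{rank}_M(X,d) := \sup\{\dim V\}$, the supremum over all real normed vector spaces $(V,\|\cdot\|)$ for which there exists an isometric map $(V,\|\cdot\|)\to (X,d)$. The rank takes values in $\mathbb{N}\cup\{\infty\}$ (with $0\in\mathbb{N}$). *)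

theory Defs
  imports "HOL-Analysis.Analysis" "HOL-Analysis.Finite_Function_Topology" "HOL-Library.Extended_Nat"
begin

definition isometric_map :: "'a set \<Rightarrow> ('a \<Rightarrow> 'a \<Rightarrow> real) \<Rightarrow> 'b set \<Rightarrow> ('b \<Rightarrow> 'b \<Rightarrow> real) \<Rightarrow> ('a \<Rightarrow> 'b) \<Rightarrow> bool"
  where "isometric_map M d M' d' f \<longleftrightarrow>
    f \<in> M \<rightarrow> M' \<and> (\<forall>x\<in>M. \<forall>y\<in>M. d' (f x) (f y) = d x y)"

text \<open>A real normed vector space is presented as a linear subspace \<open>V\<close> of some ambient real
  vector space together with a function \<open>N\<close> that is a norm on \<open>V\<close>. The values of \<open>N\<close>
  outside \<open>V\<close> are irrelevant, and \<open>N\<close> is unrelated to any norm of the ambient space.\<close>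

definition normed_subspace :: "'v::real_vector set \<Rightarrow> ('v \<Rightarrow> real) \<Rightarrow> bool"
  where "normed_subspace V N \<longleftrightarrow> subspace V \<and>
    (\<forall>v\<in>V. 0 \<le> N v) \<and>
    (\<forall>v\<in>V. N v = 0 \<longleftrightarrow> v = 0) \<and>
    (\<forall>c. \<forall>v\<in>V. N (c *\<^sub>R v) = \<bar>c\<bar> * N v) \<and>
    (\<forall>v\<in>V. \<forall>w\<in>V. N (v + w) \<le> N v + N w)"

text \<open>The library function \<^const>\<open>dim\<close> yields 0 on infinite-dimensional subspaces.\<close>

definition edim :: "'v::real_vector set \<Rightarrow> enat"
  where "edim V = (if \<exists>B. finite B \<and> V \<subseteq> span B then enat (dim V) else \<infinity>)"

text \<open>The supremum should range over all real normed spaces, which live on arbitrary types.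
  It suffices to let them be subspaces of the free real vector space \<open>'a \<Rightarrow>\<^sub>0 real\<close> on the
  type of points of \<open>X\<close>, equipped with an arbitrary norm: an isometric map into \<open>X\<close> is
  injective, so it sends a Hamel basis of its domain injectively into \<open>'a\<close>, and hence the domain
  is linearly isomorphic to such a subspace. No finite-dimensionality is assumed. The lemma
  \<open>edim_le_minkowski_rank\<close> below confirms that nothing is lost.\<close>

definition minkowski_rank :: "'a metric \<Rightarrow> enat"
  where "minkowski_rank X = Sup {edim V | (V :: ('a \<Rightarrow>\<^sub>0 real) set) N.
    normed_subspace V N \<and>
    (\<exists>f. isometric_map V (\<lambda>v w. N (v - w)) (mspace X) (mdist X) f)}"

lemma edim_linear_image:
  assumes h: "linear h" and inj: "inj_on h U" and U: "subspace U"
  shows "edim (h ` U) = edim U"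
proof -
  obtain B where B: "B \<subseteq> U" "independent B" "U \<subseteq> span B"
    using basis_exists by metis
  have spB: "span B = U" using B U by (simp add: span_minimal subset_antisym)
  have indep: "independent (h ` B)"
    using linear_independent_injective_image[OF h B(2)] inj spB by simp
  have "dim (h ` U) = card (h ` B)"
    using indep linear_span_image[OF h, of B] spB dim_span dim_eq_card_independent by metis
  also have "\<dots> = card B" using inj_on_subset[OF inj B(1)] by (simp add: card_image)
  also have "\<dots> = dim U" using B(2) spB dim_span dim_eq_card_independent by metis
  finally have d: "dim (h ` U) = dim U" .
  have "(\<exists>B. finite B \<and> h ` U \<subseteq> span B) \<longleftrightarrow> (\<exists>B. finite B \<and> U \<subseteq> span B)"
  proof
    assume "\<exists>B. finite B \<and> U \<subseteq> span B"
    then obtain B where "finite B" "U \<subseteq> span B" by blast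
    then have "finite (h ` B)" "h ` U \<subseteq> span (h ` B)"
      using linear_span_image[OF h, of B] by auto
    then show "\<exists>B. finite B \<and> h ` U \<subseteq> span B" by blast
  next
    assume "\<exists>B. finite B \<and> h ` U \<subseteq> span B"
    then obtain C where C: "finite C" "h ` U \<subseteq> span C" by blast
    have "h ` B \<subseteq> span C" using B(1) C(2) by blast
    then have "finite (h ` B)" using indep independent_span_bound[OF C(1)] by blast
    then have "finite B" using finite_imageD inj_on_subset[OF inj B(1)] by blast
    then show "\<exists>B. finite B \<and> U \<subseteq> span B" using B(3) by blast
  qed
  then show ?thesis by (simp add: edim_def d)
qed

lemma edim_le_minkowski_rank:
  fixes U :: "'v::real_vector set" and X :: "'a metric"
  assumes U: "normed_subspace U N"
    and f: "isometric_map U (\<lambda>v w. N (v - w)) (mspace X) (mdist X) f"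
  shows "edim U \<le> minkowski_rank X"
proof -
  have sU: "subspace U"
    and N0: "\<And>v. v \<in> U \<Longrightarrow> 0 \<le> N v" "\<And>v. v \<in> U \<Longrightarrow> N v = 0 \<longleftrightarrow> v = 0"
    and Ns: "\<And>c v. v \<in> U \<Longrightarrow> N (c *\<^sub>R v) = \<bar>c\<bar> * N v"
    and Nt: "\<And>v w. v \<in> U \<Longrightarrow> w \<in> U \<Longrightarrow> N (v + w) \<le> N v + N w"
    using U by (auto simp: normed_subspace_def)
  have fU: "\<And>v. v \<in> U \<Longrightarrow> f v \<in> mspace X"
    and fd: "\<And>v w. v \<in> U \<Longrightarrow> w \<in> U \<Longrightarrow> mdist X (f v) (f w) = N (v - w)"
    using f by (auto simp: isometric_map_def)
  have f_inj: "inj_on f U"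
  proof (rule inj_onI)
    fix v w assume "v \<in> U" "w \<in> U" "f v = f w"
    then have "N (v - w) = 0" using fd fU mdist_zero by metis
    then show "v = w" using N0(2) subspace_diff[OF sU \<open>v \<in> U\<close> \<open>w \<in> U\<close>] by simp
  qed
  obtain B where B: "B \<subseteq> U" "independent B" "U \<subseteq> span B"
    using basis_exists by metis
  have spB: "span B = U" using B sU by (simp add: span_minimal subset_antisym)
  define g :: "'v \<Rightarrow> ('a \<Rightarrow>\<^sub>0 real)" where "g b = Poly_Mapping.single (f b) 1" for b
  obtain h where h: "linear h" and hB: "\<And>b. b \<in> B \<Longrightarrow> h b = g b"
    using linear_independent_extend[OF B(2)] by metis
  have h_inj: "inj_on h U"
  proof (rule inj_onI)
    fix v w assume vw: "v \<in> U" "w \<in> U" "h v = h w"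
    have "v - w \<in> span B" using spB subspace_diff[OF sU] vw by simp
    then obtain S r where S: "finite S" "S \<subseteq> B" "v - w = (\<Sum>b\<in>S. r b *\<^sub>R b)"
      by (auto simp: span_explicit)
    have "0 = h (v - w)" using vw(3) by (simp add: linear_diff[OF h])
    also have "\<dots> = (\<Sum>b\<in>S. r b *\<^sub>R g b)"
      using S hB by (auto simp: linear_sum[OF h] linear_cmul[OF h] intro!: sum.cong)
    finally have z: "(\<Sum>b\<in>S. r b *\<^sub>R g b) = 0" by simp
    have "r c = 0" if c: "c \<in> S" for c
    proof -
      have sc: "Poly_Mapping.lookup (a *\<^sub>R p) i = a * Poly_Mapping.lookup p i"
        for a i and p :: "('a \<Rightarrow>\<^sub>0 real)"
        by (simp add: scaleR_poly_mapping_def Abs_poly_mapping_inverse)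
      have eqn: "f b = f c \<longleftrightarrow> b = c" if "b \<in> S" for b
        using f_inj S(2) B(1) c that by (meson inj_on_eq_iff subset_iff)
      have "0 = Poly_Mapping.lookup (\<Sum>b\<in>S. r b *\<^sub>R g b) (f c)" using z by simp
      also have "\<dots> = (\<Sum>b\<in>S. if b = c then r b else 0)"
        by (auto simp: lookup_sum sc g_def lookup_single when_def eqn intro!: sum.cong)
      also have "\<dots> = r c" using S(1) c by simp
      finally show ?thesis by simp
    qed
    then show "v = w" using S(3) by simp
  qed
  define k where "k = inv_into U h"
  have kh: "k (h v) = v" if "v \<in> U" for v
    using h_inj that by (simp add: k_def)
  have "normed_subspace (h ` U) (N \<circ> k)"
    unfolding normed_subspace_def
    by (auto simp: kh N0 Ns Nt linear_subspace_image[OF h sU] subspace_add[OF sU]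
        subspace_scale[OF sU] linear_0[OF h] subspace_0[OF sU]
        linear_add[OF h, symmetric] linear_cmul[OF h, symmetric])
      (metis kh linear_0[OF h] subspace_0[OF sU])
  moreover have "isometric_map (h ` U) (\<lambda>v w. (N \<circ> k) (v - w)) (mspace X) (mdist X) (f \<circ> k)"
    unfolding isometric_map_def
    by (auto simp: kh fU fd subspace_diff[OF sU] linear_diff[OF h, symmetric])
  ultimately have "edim (h ` U) \<le> minkowski_rank X"
    unfolding minkowski_rank_def by (intro Sup_upper) blast
  then show ?thesis by (simp add: edim_linear_image[OF h h_inj sU])
qed

end

theory Submission
  imports Defs
begin

text \<open>An isometric map \<open>(f\<^sub>1, f\<^sub>2)\<close> from a normed space \<open>V\<close> into the product pulls back two
  pseudometrics \<open>a\<close>, \<open>b\<close> with \<open>a\<^sup>2 + b\<^sup>2 = N\<^sup>2\<close>. Along a line of \<open>V\<close> the vectors \<open>(a, b)\<close>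
  attain equality in the triangle inequality of the Euclidean plane, so \<open>a\<close> and \<open>b\<close> are
  homogeneous there; letting two points run to infinity along parallel lines shows that they are
  translation invariant. Hence they come from seminorms \<open>p\<close>, \<open>q\<close>. On \<open>U = ker p\<close> the seminorm
  \<open>q\<close> is a norm, and \<open>p\<close> is a norm on any complement \<open>W\<close> of \<open>U\<close>, so \<open>U\<close> embeds into the second
  factor and \<open>W\<close> into the first.\<close>

section \<open>Dimension of direct sums\<close>

lemma edim_span_independent:
  assumes "independent B"
  shows "edim (span B) = (if finite B then enat (card B) else \<infinity>)"
proof -
  have "(\<exists>C. finite C \<and> span B \<subseteq> span C) \<longleftrightarrow> finite B"
    using independent_span_bound[OF _ assms] span_superset by blast
  then show ?thesis
    by (simp add: edim_def dim_span_eq_card_independent[OF assms] del: dim_span)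
qed

text \<open>In a vanishing combination the part over \<open>B\<close> is the negative of the part
  over \<open>C\<close>, so it lies in both spans and is zero; each part then vanishes
  separately.\<close>

lemma independent_Un:
  assumes B: "independent B" and C: "independent C" and BC: "span B \<inter> span C = {0}"
  shows "independent (B \<union> C)"
proof -
  have "u v = 0" if t: "finite t" "t \<subseteq> B \<union> C" and s: "(\<Sum>w\<in>t. u w *\<^sub>R w) = 0" and v: "v \<in> t"
    for t u v
  proof -
    have split: "(\<Sum>w\<in>t \<inter> B. u w *\<^sub>R w) + (\<Sum>w\<in>t - B. u w *\<^sub>R w) = 0"
      using sum.Int_Diff[OF t(1), of "\<lambda>w. u w *\<^sub>R w" B] s by simp
    have inB: "(\<Sum>w\<in>t \<inter> B. u w *\<^sub>R w) \<in> span B"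
      by (intro span_sum span_scale span_base) blast
    have inC: "(\<Sum>w\<in>t - B. u w *\<^sub>R w) \<in> span C"
      using t(2) by (intro span_sum span_scale span_base) blast
    have "(\<Sum>w\<in>t \<inter> B. u w *\<^sub>R w) \<in> span C"
      using split inC by (metis eq_neg_iff_add_eq_0 span_neg)
    then have "(\<Sum>w\<in>t \<inter> B. u w *\<^sub>R w) \<in> span B \<inter> span C" using inB by (rule IntI[rotated])
    then have zero: "(\<Sum>w\<in>t \<inter> B. u w *\<^sub>R w) = 0" unfolding BC by simp
    have zero': "(\<Sum>w\<in>t - B. u w *\<^sub>R w) = 0" using split unfolding zero by simp
    show "u v = 0"
    proof (cases "v \<in> B")
      case True
      then show ?thesis using independentD[OF B _ _ zero] t v by simp
    next
      case False
      then show ?thesis using independentD[OF C _ _ zero'] t v by blast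
    qed
  qed
  then show ?thesis unfolding independent_explicit_module by blast
qed

lemma edim_direct_sum:
  assumes U: "subspace U" and W: "subspace W" and UW: "U \<inter> W = {0}"
  shows "edim {u + w | u w. u \<in> U \<and> w \<in> W} = edim U + edim W"
proof -
  obtain B where B: "independent B" "span B = U"
    using basis_exists[of U] U by (metis span_minimal subset_antisym)
  obtain C where C: "independent C" "span C = W"
    using basis_exists[of W] W by (metis span_minimal subset_antisym)
  have indep: "independent (B \<union> C)" using independent_Un B C UW by blast
  \<comment> \<open>A common basis vector would lie in \<open>U \<inter> W\<close>, hence be 0,
    which no independent set contains. So cardinalities of bases add up.\<close>
  have "B \<inter> C \<subseteq> {0}" using span_superset[of B] span_superset[of C] B C UW by blast
  then have disj: "B \<inter> C = {}" using dependent_zero[of B] B(1) by blast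
  have "edim {u + w | u w. u \<in> U \<and> w \<in> W} = edim (span (B \<union> C))"
    by (simp add: span_Un B C)
  also have "\<dots> = edim (span B) + edim (span C)"
    using disj by (simp add: edim_span_independent[OF B(1)] edim_span_independent[OF C(1)]
        edim_span_independent[OF indep] card_Un_disjoint)
  finally show ?thesis by (simp add: B(2) C(2))
qed

lemma subspace_complement_exists:
  assumes U: "subspace U" and V: "subspace V" and UV: "U \<subseteq> V"
  obtains W where "subspace W" "U \<inter> W = {0}" "{u + w | u w. u \<in> U \<and> w \<in> W} = V"
proof -
  obtain A where A: "independent A" "span A = U"
    using basis_exists[of U] U by (metis span_minimal subset_antisym)
  then have "A \<subseteq> V" using UV span_superset by blast
  then obtain B where B: "A \<subseteq> B" "B \<subseteq> V" "independent B" "V \<subseteq> span B"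
    using maximal_independent_subset_extend A(1) by metis
  have spB: "span B = V" using B V by (simp add: span_minimal subset_antisym)
  \<comment> \<open>On \<open>V\<close> this is the projection onto \<open>span (B - A)\<close>
    along \<open>U\<close>. A vector in both subspaces is killed and fixed at once, so it is
    0.\<close>
  obtain h where h: "linear h" and hB: "\<And>b. b \<in> B \<Longrightarrow> h b = (if b \<in> A then 0 else b)"
    using linear_independent_extend[OF B(3), of "\<lambda>b. if b \<in> A then 0 else b"] by blast
  have hU: "h u = 0" if "u \<in> U" for u
    using linear_eq_0_on_span[OF h _ that[folded A(2)]] hB B(1) by (simp add: subset_iff)
  have hW: "h w = w" if "w \<in> span (B - A)" for w
    using linear_eq_on[OF h linear_id that] hB by simp
  have "U \<inter> span (B - A) = {0}"
    using hU hW subspace_0[OF U] span_zero by fastforce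
  moreover have "{u + w | u w. u \<in> U \<and> w \<in> span (B - A)} = V"
    using span_Un[of A "B - A"] A(2) spB B(1) by (simp add: Un_absorb1)
  ultimately show ?thesis using that subspace_span by blast
qed

section \<open>Splitting a norm along a pair of pseudometrics\<close>

text \<open>The plane vectors \<open>(a, b)\<close>, \<open>(a', b')\<close> and
  \<open>(c, d)\<close> have lengths \<open>n\<close>, \<open>t * n\<close> and
  \<open>(1 + t) * n\<close>, and \<open>(c, d)\<close> is componentwise at most the sum of the
  other two. This forces equality in the triangle inequality, which makes the vectors
  parallel.\<close>

lemma parallel_of_euclidean_triangle_equality:
  fixes a b a' b' c d n t :: real
  assumes nonneg: "0 \<le> a" "0 \<le> b" "0 \<le> c" "0 \<le> d" "0 \<le> t"
    and norms: "a\<^sup>2 + b\<^sup>2 = n\<^sup>2" "a'\<^sup>2 + b'\<^sup>2 = (t * n)\<^sup>2" "c\<^sup>2 + d\<^sup>2 = ((1 + t) * n)\<^sup>2"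
    and le: "c \<le> a + a'" "d \<le> b + b'"
  shows "a' = t * a" and "c = (1 + t) * a"
proof -
  have "c\<^sup>2 \<le> (a + a')\<^sup>2" "d\<^sup>2 \<le> (b + b')\<^sup>2"
    using nonneg le by (auto intro: power_mono)
  then have "((1 + t) * n)\<^sup>2 \<le> (a + a')\<^sup>2 + (b + b')\<^sup>2" using norms(3) by linarith
  moreover have "(a + a')\<^sup>2 + (b + b')\<^sup>2 = n\<^sup>2 + (t * n)\<^sup>2 + 2 * (a * a' + b * b')"
    unfolding norms(1,2)[symmetric] by (simp add: power2_eq_square algebra_simps)
  ultimately have "t * n\<^sup>2 \<le> a * a' + b * b'"
    by (simp add: power2_eq_square algebra_simps)
  \<comment> \<open>The preceding bound is equality in Cauchy-Schwarz; it makes the squared distance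
    from \<open>(a', b')\<close> to \<open>t\<close> times \<open>(a, b)\<close> nonpositive.
    Multiplying by \<open>t\<close> instead of dividing also covers \<open>t = 0\<close>.\<close>
  then have "t * (t * n\<^sup>2) \<le> t * (a * a' + b * b')" using nonneg(5) by (rule mult_left_mono)
  moreover have "(a' - t * a)\<^sup>2 + (b' - t * b)\<^sup>2
      = (a'\<^sup>2 + b'\<^sup>2) + t * t * (a\<^sup>2 + b\<^sup>2) - 2 * (t * (a * a' + b * b'))"
    by (simp add: power2_eq_square algebra_simps)
  ultimately have "(a' - t * a)\<^sup>2 + (b' - t * b)\<^sup>2 \<le> 0"
    unfolding norms(1,2) by (simp add: power2_eq_square algebra_simps)
  then have par: "a' = t * a" "b' = t * b"
    by (smt (verit) zero_le_power2 power2_eq_iff_nonneg zero_eq_power2)+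
  then show "a' = t * a" by simp
  have le': "c \<le> (1 + t) * a" "d \<le> (1 + t) * b" using le par by (simp_all add: algebra_simps)
  \<comment> \<open>Both coordinates are bounded above and the sums of squares agree, so neither
    coordinate can fall short.\<close>
  have "c\<^sup>2 + d\<^sup>2 = ((1 + t) * a)\<^sup>2 + ((1 + t) * b)\<^sup>2"
    using norms(1) unfolding norms(3) by (simp add: power_mult_distrib flip: distrib_left)
  moreover have "d\<^sup>2 \<le> ((1 + t) * b)\<^sup>2" using le'(2) nonneg by (intro power_mono) auto
  ultimately have "((1 + t) * a)\<^sup>2 \<le> c\<^sup>2" by linarith
  then have "(1 + t) * a \<le> c" using nonneg(3) by (rule power2_le_imp_le)
  with le'(1) show "c = (1 + t) * a" by simp
qed

text \<open>The triangle inequalities and \<open>sum_squares\<close> are restricted to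
  \<open>V\<close> because the pulled-back distances are controlled only where the isometric map
  lands in the space; \<open>mdist\<close> is nonnegative and symmetric everywhere.\<close>

locale norm_splitting =
  fixes V :: "'v::real_vector set" and N :: "'v \<Rightarrow> real" and a b :: "'v \<Rightarrow> 'v \<Rightarrow> real"
  assumes normed: "normed_subspace V N"
    and a_nonneg: "\<And>x y. 0 \<le> a x y" and b_nonneg: "\<And>x y. 0 \<le> b x y"
    and a_commute: "\<And>x y. a x y = a y x"
    and b_commute: "\<And>x y. b x y = b y x"
    and a_triangle: "\<And>x y z. x \<in> V \<Longrightarrow> y \<in> V \<Longrightarrow> z \<in> V \<Longrightarrow> a x z \<le> a x y + a y z"
    and b_triangle: "\<And>x y z. x \<in> V \<Longrightarrow> y \<in> V \<Longrightarrow> z \<in> V \<Longrightarrow> b x z \<le> b x y + b y z"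
    and sum_squares: "\<And>x y. x \<in> V \<Longrightarrow> y \<in> V \<Longrightarrow> (a x y)\<^sup>2 + (b x y)\<^sup>2 = (N (x - y))\<^sup>2"
begin

lemma V_closed: "subspace V" "0 \<in> V" "x \<in> V \<Longrightarrow> y \<in> V \<Longrightarrow> x + y \<in> V"
  "x \<in> V \<Longrightarrow> y \<in> V \<Longrightarrow> x - y \<in> V" "x \<in> V \<Longrightarrow> - x \<in> V" "x \<in> V \<Longrightarrow> c *\<^sub>R x \<in> V"
proof -
  show "subspace V" using normed by (simp add: normed_subspace_def)
qed (use normed in \<open>auto simp: normed_subspace_def
    intro: subspace_0 subspace_add subspace_diff subspace_neg subspace_scale\<close>)

lemma N_scale: "v \<in> V \<Longrightarrow> N (c *\<^sub>R v) = \<bar>c\<bar> * N v"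
  using normed by (simp add: normed_subspace_def)

lemma N_minus: "v \<in> V \<Longrightarrow> N (- v) = N v"
  using N_scale[of v "-1"] by simp

lemma N_nonneg: "v \<in> V \<Longrightarrow> 0 \<le> N v"
  using normed by (simp add: normed_subspace_def)

lemma a_le_N:
  assumes "x \<in> V" "y \<in> V"
  shows "a x y \<le> N (x - y)"
proof (rule power2_le_imp_le)
  show "(a x y)\<^sup>2 \<le> (N (x - y))\<^sup>2"
    using sum_squares[OF assms] zero_le_power2[of "b x y"] by linarith
  show "0 \<le> N (x - y)" using N_nonneg V_closed(4) assms by blast
qed

text \<open>The points \<open>x\<close>, \<open>x + v\<close>,
  \<open>x + (1 + t) *\<^sub>R v\<close> lie in this order on a line, so their
  \<open>N\<close>-distances add up and the Euclidean equality case applies to the pairs of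
  \<open>a\<close>- and \<open>b\<close>-distances.\<close>

lemma a_on_line:
  assumes x: "x \<in> V" and v: "v \<in> V" and t: "0 \<le> t"
  shows "a (x + v) (x + (1 + t) *\<^sub>R v) = t * a x (x + v)" (is ?step)
    and "a x (x + (1 + t) *\<^sub>R v) = (1 + t) * a x (x + v)" (is ?scale)
proof -
  let ?y = "x + v" and ?z = "x + (1 + t) *\<^sub>R v"
  have yz: "?y \<in> V" "?z \<in> V" using x v by (auto intro: V_closed)
  have "(a x ?y)\<^sup>2 + (b x ?y)\<^sup>2 = (N v)\<^sup>2"
    using sum_squares[OF x yz(1)] v by (simp add: N_minus)
  moreover have "(a ?y ?z)\<^sup>2 + (b ?y ?z)\<^sup>2 = (t * N v)\<^sup>2"
  proof -
    have "?y - ?z = (- t) *\<^sub>R v" by (simp add: algebra_simps)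
    then show ?thesis using sum_squares[OF yz] N_scale[OF v, of "- t"] t by simp
  qed
  moreover have "(a x ?z)\<^sup>2 + (b x ?z)\<^sup>2 = ((1 + t) * N v)\<^sup>2"
  proof -
    have "x - ?z = (- (1 + t)) *\<^sub>R v" by (simp add: algebra_simps)
    then show ?thesis
      using sum_squares[OF x yz(2)] N_scale[OF v, of "- (1 + t)"] t by (simp add: add.commute)
  qed
  ultimately have "a ?y ?z = t * a x ?y \<and> a x ?z = (1 + t) * a x ?y"
    using parallel_of_euclidean_triangle_equality[OF a_nonneg b_nonneg a_nonneg b_nonneg t
        _ _ _ a_triangle[OF x yz] b_triangle[OF x yz]]
    by simp
  then show ?step ?scale by simp_all
qed

text \<open>A positive excess \<open>e\<close> would grow linearly along the two parallel rays,
  while corresponding points stay \<open>N (x - y)\<close> apart, so the triangle inequality bounds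
  the excess by \<open>2 * N (x - y)\<close>.\<close>

lemma a_parallel_le:
  assumes x: "x \<in> V" and y: "y \<in> V" and v: "v \<in> V"
  shows "a x (x + v) \<le> a y (y + v)"
proof (rule ccontr)
  define e where "e = a x (x + v) - a y (y + v)"
  assume "\<not> ?thesis"
  then have e: "0 < e" by (simp add: e_def)
  have bound: "(1 + t) * e \<le> 2 * N (x - y)" if t: "0 \<le> t" for t
  proof -
    let ?x = "x + (1 + t) *\<^sub>R v" and ?y = "y + (1 + t) *\<^sub>R v"
    have xy: "?x \<in> V" "?y \<in> V" using x y v by (auto intro: V_closed)
    have "a x ?x \<le> a x y + a y ?y + a ?y ?x"
      using a_triangle[OF x y xy(1)] a_triangle[OF y xy(2,1)] by linarith
    also have "\<dots> \<le> N (x - y) + a y ?y + N (x - y)"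
      using a_le_N[OF x y] a_le_N[OF xy] a_commute[of ?y ?x] by simp
    finally show ?thesis
      using a_on_line(2)[OF x v t] a_on_line(2)[OF y v t] by (simp add: e_def algebra_simps)
  qed
  have "0 \<le> N (x - y)" using N_nonneg V_closed(4) x y by blast
  \<comment> \<open>With \<open>t = 2 * N (x - y) / e\<close> the left side is
    \<open>e + 2 * N (x - y)\<close>, which is too large.\<close>
  then have "(1 + 2 * N (x - y) / e) * e \<le> 2 * N (x - y)" using bound e by simp
  then show False using e by (simp add: distrib_right)
qed

lemma a_translation_invariant:
  assumes "x \<in> V" "y \<in> V"
  shows "a x y = a 0 (x - y)"
proof -
  have "a y (y + (x - y)) = a 0 (0 + (x - y))"
    using assms by (intro antisym a_parallel_le) (auto intro: V_closed)
  then show ?thesis by (simp add: a_commute)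
qed

lemma a_add_le:
  assumes "v \<in> V" "w \<in> V"
  shows "a 0 (v + w) \<le> a 0 v + a 0 w"
  using a_triangle[of 0 v "v + w"] a_translation_invariant[of "v + w" v] assms
  by (simp add: V_closed a_commute)

lemma a_scale:
  assumes v: "v \<in> V"
  shows "a 0 (c *\<^sub>R v) = \<bar>c\<bar> * a 0 v"
proof -
  have pos: "a 0 (t *\<^sub>R v) = t * a 0 v" if t: "0 \<le> t" for t
  proof -
    \<comment> \<open>The segment from \<open>v\<close> to \<open>(1 + t) *\<^sub>R v\<close> is a
      translate of the one from 0 to \<open>t *\<^sub>R v\<close>. Using it instead of the whole
      segment from 0 reaches factors below 1.\<close>
    have "a v ((1 + t) *\<^sub>R v) = a 0 ((1 + t) *\<^sub>R v - v)"
      using v a_translation_invariant[of "(1 + t) *\<^sub>R v" v] by (simp add: V_closed a_commute)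
    then show ?thesis using a_on_line(1)[OF V_closed(2) v t] by (simp add: algebra_simps)
  qed
  have neg: "a 0 (- w) = a 0 w" if "w \<in> V" for w
    using a_translation_invariant[of 0 w] that by (simp add: V_closed)
  show ?thesis
  proof (cases "0 \<le> c")
    case False
    then show ?thesis
      using pos[of "- c"] neg[of "(- c) *\<^sub>R v"] v by (simp add: V_closed)
  qed (simp add: pos)
qed

lemma a_zero: "a 0 0 = 0"
  using a_scale[of 0 0] V_closed by simp

lemma subspace_kernel: "subspace {v \<in> V. a 0 v = 0}"
proof (rule subspaceI)
  fix v w assume "v \<in> {v \<in> V. a 0 v = 0}" "w \<in> {v \<in> V. a 0 v = 0}"
  then show "v + w \<in> {v \<in> V. a 0 v = 0}"
    using a_add_le[of v w] a_nonneg[of 0 "v + w"] by (simp add: V_closed)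
qed (auto simp: V_closed a_zero a_scale)

lemma normed_subspace_a:
  assumes "subspace W" "W \<subseteq> V" "\<And>w. w \<in> W \<Longrightarrow> a 0 w = 0 \<Longrightarrow> w = 0"
  shows "normed_subspace W (a 0)"
proof -
  have "a 0 v = 0 \<longleftrightarrow> v = 0" if "v \<in> W" for v using assms(3) a_zero that by blast
  then show ?thesis
    unfolding normed_subspace_def using assms(1) a_nonneg a_scale a_add_le subsetD[OF assms(2)]
    by blast
qed

text \<open>The assumptions are symmetric in \<open>a\<close> and \<open>b\<close>, so every fact
  about \<open>a\<close> transfers to \<open>b\<close>.\<close>

lemma swap: "norm_splitting V N b a"
proof
  show "(b x y)\<^sup>2 + (a x y)\<^sup>2 = (N (x - y))\<^sup>2" if "x \<in> V" "y \<in> V" for x y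
    using sum_squares[OF that] by simp
qed (fact normed a_nonneg b_nonneg a_commute b_commute a_triangle b_triangle)+

end

section \<open>The Minkowski rank of a product\<close>

lemma edim_le_sum_minkowski_ranks:
  fixes V :: "'v::real_vector set"
  assumes V: "normed_subspace V N"
    and f: "isometric_map V (\<lambda>v w. N (v - w))
      (mspace (prod_metric X\<^sub>1 X\<^sub>2)) (mdist (prod_metric X\<^sub>1 X\<^sub>2)) f"
  shows "edim V \<le> minkowski_rank X\<^sub>1 + minkowski_rank X\<^sub>2"
proof -
  define a where "a x y = mdist X\<^sub>1 (fst (f x)) (fst (f y))" for x y
  define b where "b x y = mdist X\<^sub>2 (snd (f x)) (snd (f y))" for x y
  have fV: "fst (f x) \<in> mspace X\<^sub>1" "snd (f x) \<in> mspace X\<^sub>2" if "x \<in> V" for x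
    using f that by (auto simp: isometric_map_def Pi_iff mem_Times_iff)
  have dist: "N (x - y) = sqrt ((a x y)\<^sup>2 + (b x y)\<^sup>2)" if "x \<in> V" "y \<in> V" for x y
    using f that by (auto simp: isometric_map_def prod_dist_def a_def b_def split_beta)
  interpret A: norm_splitting V N a b
  proof
    show "normed_subspace V N" by (rule V)
    show "a x y = a y x" "b x y = b y x" for x y
      unfolding a_def b_def by (rule mdist_commute)+
    show "a x z \<le> a x y + a y z" "b x z \<le> b x y + b y z"
      if "x \<in> V" "y \<in> V" "z \<in> V" for x y z
      unfolding a_def b_def by (intro mdist_triangle fV that)+
    show "(a x y)\<^sup>2 + (b x y)\<^sup>2 = (N (x - y))\<^sup>2" if "x \<in> V" "y \<in> V" for x y
      by (simp add: dist that)
  qed (simp_all add: a_def b_def)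
  interpret B: norm_splitting V N b a by (rule A.swap)
  define U where "U = {v \<in> V. a 0 v = 0}"
  have U: "subspace U" "U \<subseteq> V" using A.subspace_kernel by (auto simp: U_def)
  obtain W where W: "subspace W" "U \<inter> W = {0}" "{u + w | u w. u \<in> U \<and> w \<in> W} = V"
    by (rule subspace_complement_exists[OF U(1) A.V_closed(1) U(2)])
  have WV: "W \<subseteq> V" using W(3) subspace_0[OF U(1)] by force
  have "normed_subspace W (a 0)"
    using W WV by (intro A.normed_subspace_a) (auto simp: U_def)
  moreover have "isometric_map W (\<lambda>v w. a 0 (v - w)) (mspace X\<^sub>1) (mdist X\<^sub>1) (fst \<circ> f)"
    unfolding isometric_map_def
  proof (intro conjI ballI Pi_I)
    fix x y assume "x \<in> W" "y \<in> W"
    then show "mdist X\<^sub>1 ((fst \<circ> f) x) ((fst \<circ> f) y) = a 0 (x - y)"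
      using A.a_translation_invariant[of x y] WV unfolding a_def o_def by blast
  qed (use WV fV in auto)
  \<comment> \<open>\<open>W\<close> lives in the ambient type of \<open>V\<close>, not in the free
    space on the points of \<open>X\<^sub>1\<close>; \<open>edim_le_minkowski_rank\<close> bridges
    this.\<close>
  ultimately have "edim W \<le> minkowski_rank X\<^sub>1" by (rule edim_le_minkowski_rank)
  moreover have "edim U \<le> minkowski_rank X\<^sub>2"
  proof (rule edim_le_minkowski_rank)
    show "normed_subspace U (b 0)"
    proof (rule B.normed_subspace_a[OF U])
      fix u assume u: "u \<in> U" "b 0 u = 0"
      \<comment> \<open>Both components of the distance from \<open>u\<close> to 0 vanish:
        \<open>a\<close> by the choice of \<open>U\<close>, \<open>b\<close> by assumption.\<close>
      then have "N (u - 0) = 0"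
        using dist[of u 0] A.a_commute[of u 0] A.b_commute[of u 0] A.V_closed(2)
        unfolding U_def by simp
      then show "u = 0" using u V by (simp add: U_def normed_subspace_def)
    qed
    show "isometric_map U (\<lambda>v w. b 0 (v - w)) (mspace X\<^sub>2) (mdist X\<^sub>2) (snd \<circ> f)"
      unfolding isometric_map_def
    proof (intro conjI ballI Pi_I)
      fix x y assume "x \<in> U" "y \<in> U"
      then show "mdist X\<^sub>2 ((snd \<circ> f) x) ((snd \<circ> f) y) = b 0 (x - y)"
        using B.a_translation_invariant[of x y] U(2) unfolding b_def o_def by blast
    qed (use U(2) fV in auto)
  qed
  ultimately have "edim U + edim W \<le> minkowski_rank X\<^sub>2 + minkowski_rank X\<^sub>1"
    by (simp add: add_mono)
  then show ?thesis using edim_direct_sum[OF U(1) W(1,2)] unfolding W(3)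
    by (simp add: add.commute)
qed

section \<open>Lower bound for the rank of the product\<close>

lemma edim_Times:
  fixes V :: "'v::real_vector set" and W :: "'w::real_vector set"
  assumes V: "subspace V" and W: "subspace W"
  shows "edim (V \<times> W) = edim V + edim W"
proof -
  let ?i = "\<lambda>v::'v. (v, 0::'w)" and ?j = "\<lambda>w::'w. (0::'v, w)"
  have i: "linear ?i" "inj_on ?i V" and j: "linear ?j" "inj_on ?j W"
    by (auto intro!: linearI inj_onI)
  have sum: "{u + w | u w. u \<in> ?i ` V \<and> w \<in> ?j ` W} = V \<times> W" by force
  have "?i ` V \<inter> ?j ` W = {0}"
    using subspace_0[OF V] subspace_0[OF W] by (auto simp: zero_prod_def)
  from edim_direct_sum[OF linear_subspace_image[OF i(1) V] linear_subspace_image[OF j(1) W] this]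
  show ?thesis unfolding sum edim_linear_image[OF i V] edim_linear_image[OF j W] .
qed

text \<open>The Euclidean norm is monotone on nonnegative pairs, which reduces the triangle
  inequality to the one in the plane.\<close>

lemma normed_subspace_Times:
  assumes V: "normed_subspace V N" and W: "normed_subspace W M"
  shows "normed_subspace (V \<times> W) (\<lambda>x. sqrt ((N (fst x))\<^sup>2 + (M (snd x))\<^sup>2))"
proof -
  have tri: "sqrt ((N (v + v'))\<^sup>2 + (M (w + w'))\<^sup>2)
      \<le> sqrt ((N v)\<^sup>2 + (M w)\<^sup>2) + sqrt ((N v')\<^sup>2 + (M w')\<^sup>2)"
    if "v \<in> V" "v' \<in> V" "w \<in> W" "w' \<in> W" for v v' w w'
  proof -
    have "N (v + v') \<le> N v + N v'" "M (w + w') \<le> M w + M w'"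
      "0 \<le> N (v + v')" "0 \<le> M (w + w')"
      using V W that by (auto simp: normed_subspace_def subspace_add)
    then have "sqrt ((N (v + v'))\<^sup>2 + (M (w + w'))\<^sup>2)
        \<le> sqrt ((N v + N v')\<^sup>2 + (M w + M w')\<^sup>2)"
      by (intro real_sqrt_le_mono add_mono power_mono)
    also have "\<dots> \<le> sqrt ((N v)\<^sup>2 + (M w)\<^sup>2) + sqrt ((N v')\<^sup>2 + (M w')\<^sup>2)"
      by (rule real_sqrt_sum_squares_triangle_ineq)
    finally show ?thesis .
  qed
  have scale: "sqrt ((\<bar>c\<bar> * x)\<^sup>2 + (\<bar>c\<bar> * y)\<^sup>2) = \<bar>c\<bar> * sqrt (x\<^sup>2 + y\<^sup>2)" for c x y :: real
    by (simp add: power_mult_distrib real_sqrt_mult flip: distrib_left)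
  show ?thesis
    using V W tri unfolding normed_subspace_def
    by (auto simp: subspace_Times scale zero_prod_def simp del: power_mult_distrib)
qed

lemma sum_edims_le_minkowski_rank_prod:
  fixes V :: "'v::real_vector set" and W :: "'w::real_vector set"
  assumes V: "normed_subspace V N" and W: "normed_subspace W M"
    and f: "isometric_map V (\<lambda>v w. N (v - w)) (mspace X\<^sub>1) (mdist X\<^sub>1) f"
    and g: "isometric_map W (\<lambda>v w. M (v - w)) (mspace X\<^sub>2) (mdist X\<^sub>2) g"
  shows "edim V + edim W \<le> minkowski_rank (prod_metric X\<^sub>1 X\<^sub>2)"
proof -
  have "isometric_map (V \<times> W) (\<lambda>x y. sqrt ((N (fst (x - y)))\<^sup>2 + (M (snd (x - y)))\<^sup>2))
      (mspace (prod_metric X\<^sub>1 X\<^sub>2)) (mdist (prod_metric X\<^sub>1 X\<^sub>2)) (map_prod f g)"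
    using f g by (auto simp: isometric_map_def prod_dist_def)
  then have "edim (V \<times> W) \<le> minkowski_rank (prod_metric X\<^sub>1 X\<^sub>2)"
    by (rule edim_le_minkowski_rank[OF normed_subspace_Times[OF V W]])
  then show ?thesis using V W by (simp add: edim_Times normed_subspace_def)
qed

text \<open>For finite \<open>c\<close> both sets are bounded, hence finite, so the suprema are
  attained as maxima and \<open>le\<close> applies to them. If one set were empty, \<open>le\<close>
  would say nothing about the other.\<close>

lemma Sup_enat_add_le:
  fixes A B :: "enat set"
  assumes ne: "A \<noteq> {}" "B \<noteq> {}" and le: "\<And>x y. x \<in> A \<Longrightarrow> y \<in> B \<Longrightarrow> x + y \<le> c"
  shows "Sup A + Sup B \<le> c"
proof (cases c)
  case (enat n)
  obtain x y where xy: "x \<in> A" "y \<in> B" using ne by blast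
  have "u \<le> enat n" if "u \<in> A" for u
    using le[OF that xy(2)] enat by (metis le_iff_add order_trans)
  then have "finite A" by (rule finite_enat_bounded)
  moreover have "v \<le> enat n" if "v \<in> B" for v
    using le[OF xy(1) that] enat by (metis add.commute le_iff_add order_trans)
  then have "finite B" by (rule finite_enat_bounded)
  ultimately show ?thesis using ne le by (simp add: Sup_enat_def)
qed simp

text \<open>The zero space embeds at any point. Here nonemptiness of the factors enters: an empty
  factor would make the product empty, of rank \<open>Sup {} = 0\<close>, whatever the rank of the
  other factor.\<close>

lemma minkowski_rank_candidates_nonempty:
  fixes X :: "'a metric"
  assumes "mspace X \<noteq> {}"
  shows "{edim V | (V :: ('a \<Rightarrow>\<^sub>0 real) set) N. normed_subspace V N \<and>
    (\<exists>f. isometric_map V (\<lambda>v w. N (v - w)) (mspace X) (mdist X) f)} \<noteq> {}"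
proof -
  obtain x where "x \<in> mspace X" using assms by blast
  then have "isometric_map {0 :: 'a \<Rightarrow>\<^sub>0 real} (\<lambda>v w. 0) (mspace X) (mdist X) (\<lambda>_. x)"
    by (simp add: isometric_map_def)
  moreover have "normed_subspace {0 :: 'a \<Rightarrow>\<^sub>0 real} (\<lambda>_. 0)"
    by (simp add: normed_subspace_def)
  ultimately show ?thesis by blast
qed

theorem theorem2:
  fixes X\<^sub>1 :: "'a metric" and X\<^sub>2 :: "'b metric"
  assumes "mspace X\<^sub>1 \<noteq> {}" and "mspace X\<^sub>2 \<noteq> {}"
  shows "minkowski_rank X\<^sub>1 + minkowski_rank X\<^sub>2 = minkowski_rank (prod_metric X\<^sub>1 X\<^sub>2)"
proof (rule antisym)
  show "minkowski_rank X\<^sub>1 + minkowski_rank X\<^sub>2 \<le> minkowski_rank (prod_metric X\<^sub>1 X\<^sub>2)"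
    unfolding minkowski_rank_def[of X\<^sub>1] minkowski_rank_def[of X\<^sub>2]
  proof (rule Sup_enat_add_le[OF minkowski_rank_candidates_nonempty[OF assms(1)]
        minkowski_rank_candidates_nonempty[OF assms(2)]], elim CollectE exE conjE)
    fix x y V N W M f g
    assume "x = edim V" "y = edim W"
      and "normed_subspace V N" "isometric_map V (\<lambda>v w. N (v - w)) (mspace X\<^sub>1) (mdist X\<^sub>1) f"
      and "normed_subspace W M" "isometric_map W (\<lambda>v w. M (v - w)) (mspace X\<^sub>2) (mdist X\<^sub>2) g"
    then show "x + y \<le> minkowski_rank (prod_metric X\<^sub>1 X\<^sub>2)"
      using sum_edims_le_minkowski_rank_prod by metis
  qed
  show "minkowski_rank (prod_metric X\<^sub>1 X\<^sub>2) \<le> minkowski_rank X\<^sub>1 + minkowski_rank X\<^sub>2"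
    unfolding minkowski_rank_def[of "prod_metric X\<^sub>1 X\<^sub>2"]
  proof (rule Sup_least, elim CollectE exE conjE)
    fix x V N f
    assume "x = edim V" "normed_subspace V N"
      and "isometric_map V (\<lambda>v w. N (v - w))
        (mspace (prod_metric X\<^sub>1 X\<^sub>2)) (mdist (prod_metric X\<^sub>1 X\<^sub>2)) f"
    then show "x \<le> minkowski_rank X\<^sub>1 + minkowski_rank X\<^sub>2"
      using edim_le_sum_minkowski_ranks by metis
  qed
qed

end
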